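(* Let $\mathbf{S}$ be a canonical single-parameter exponential family with open mean range $\mathbf{O}=(\underline{\mu},\overline{\mu})$ and divergence $d(\cdot,\cdot)$. Let $\nu\in\mathbf{S}$ have mean $\mu$, let $N_\delta\to\infty$ as $\delta\to0$, and let $\pi\in\Pi^{s}_{\rm CI}$ be any stable confidence-interval policy, with limiting endpoints $\mu_L^\pi(\mu)\le\mu\le\mu_R^\pi(\mu)$. Then: (a) (No learning regime) If $\lim_{\delta\to0}\frac{N_\delta}{\log(1/\delta)}=0$, then $\mu_R^\pi(\mu)-\mu_L^\pi(\mu)=\overline{\mu}-\underline{\mu}$. Further, $\widehat{\mu}^\pi_L(N_\delta,\delta)\overset{p}{\to}\underline{\mu}$ and $\widehat{\mu}^\pi_R(N_\delta,\delta)\overset{p}{\to}\overline{\mu}$ as $\delta\to0$. (b) (Sufficient learning regime) If $\lim_{\delta\to0}\frac{N_\delta}{\log(1/\delta)}=k$ with $k\in(0,\infty)$, then $$\mu_R^\pi(\mu)-\mu_L^\pi(\mu)\ \ge\ \mu_R^*(\mu,k)-\mu_L^*(\mu,k),$$ where $\mu_L^*(\mu,k)<\mu$ and $\mu_R^*(\mu,k)>\mu$ uniquely solve $$d(\mu,\mu_R^*(\mu,k))=d(\mu,\mu_L^*(\mu,k))=\frac1k .$$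
   Context: Exponential family. Fix a reference measure $\xi$ on $\mathbb{R}$. $\mathbf{S}=\{p_\theta:\theta\in\Theta\}$, with $\frac{dp_\theta}{d\xi}(x)=\exp(\theta x-b(\theta))$, where $\Theta=\{\theta\in\mathbb{R}:\int|x|e^{\theta x}\,d\xi(x)<\infty\}$ is assumed to be an open interval $(\underline\theta,\overline\theta)$, and $b$ is a known, twice differentiable, strictly convex function. The mean of $p_\theta$ is $b'(\theta)$, strictly increasing in $\theta$; its inverse is $\mu\mapsto\theta(\mu)$. The set of means (the "support of the mean") is the open interval $\mathbf{O}=(\underline\mu,\overline\mu)$. For $\mu,\tilde\mu\in\mathbf{O}$, $d(\mu,\tilde\mu)=KL(p_{\theta(\mu)},p_{\theta(\tilde\mu)})=b(\theta(\tilde\mu))-b(\theta(\mu))-b'(\theta(\mu))(\theta(\tilde\mu)-\theta(\mu))$, where $KL$ is the Kullback–Leibler divergence. Policies. $X_1,X_2,\dots$ are i.i.d. from $\nu$; $\mathbb{P}_\nu$ is the corresponding probability. A policy $\pi$ assigns to each $n\in\mathbb{N}$ and $\delta\in(0,1)$ an interval $[\widehat\mu_L^\pi(n,\delta),\widehat\mu_R^\pi(n,\delta)]$ computed from $X_1,\dots,X_n$. $\Pi_{\rm CI}$ is the set of policies such that for every $\nu\in\mathbf{S}$ with mean $\mu$, every $\delta\in(0,1)$ and every $n\in\mathbb{N}$, $\mathbb{P}_\nu(\mu\in[\widehat\mu_L^\pi(n,\delta),\widehat\mu_R^\pi(n,\delta)])\ge1-\delta$. Stability. Let $N_\delta\to\infty$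 as $\delta\to0$ (sample size as a function of $\delta$). For a given $\nu$ with mean $\mu$, a policy $\pi\in\Pi_{\rm CI}$ is stable if, whenever $\lim_{\delta\to0}N_\delta/\log(1/\delta)\in[0,\infty]$, one has under $\mathbb{P}_\nu$, as $\delta\to0$, $\widehat\mu_L^\pi(N_\delta,\delta)\overset{p}{\to}\mu_L^\pi(\mu)$ and $\widehat\mu_R^\pi(N_\delta,\delta)\overset{p}{\to}\mu_R^\pi(\mu)$, where $\mu_L^\pi(\mu)\le\mu$ and $\mu_R^\pi(\mu)\ge\mu$ are deterministic constants ($-\infty$ and $\infty$ included). $\Pi^s_{\rm CI}$ is the set of stable policies in $\Pi_{\rm CI}$.
   Formalization: Confidence intervals are required to lie in the closed hull of O (otherwise (a) fails, e.g. for [-∞,∞]); if d(μ,·) stays below 1/k on one side of μ, so that no solution exists there, the corresponding μ_L^* or μ_R^* is taken to be the endpoint of O. *)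

theory Defs
  imports "HOL-Probability.Probability"
begin

section \<open>Canonical one-parameter exponential families\<close>

definition strictly_convex_on :: "real set \<Rightarrow> (real \<Rightarrow> real) \<Rightarrow> bool" where
  "strictly_convex_on S f \<longleftrightarrow> convex S \<and>
     (\<forall>x\<in>S. \<forall>y\<in>S. \<forall>u\<in>{0<..<1}. x \<noteq> y \<longrightarrow>
        f (u * x + (1 - u) * y) < u * f x + (1 - u) * f y)"

definition nat_params :: "real measure \<Rightarrow> real set" where
  "nat_params \<xi> = {\<theta>. (\<integral>\<^sup>+ x. ennreal (\<bar>x\<bar> * exp (\<theta> * x)) \<partial>\<xi>) < \<infinity>}"

definition expfam_dist :: "real measure \<Rightarrow> (real \<Rightarrow> real) \<Rightarrow> real \<Rightarrow> real measure" where
  "expfam_dist \<xi> b \<theta> = density \<xi> (\<lambda>x. ennreal (exp (\<theta> * x - b \<theta>)))"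

definition exponential_family :: "real measure \<Rightarrow> (real \<Rightarrow> real) \<Rightarrow> bool" where
  "exponential_family \<xi> b \<longleftrightarrow>
     sets \<xi> = sets borel \<and>
     nat_params \<xi> \<noteq> {} \<and> open (nat_params \<xi>) \<and> is_interval (nat_params \<xi>) \<and>
     (\<forall>\<theta>\<in>nat_params \<xi>. prob_space (expfam_dist \<xi> b \<theta>)) \<and>
     (\<forall>\<theta>\<in>nat_params \<xi>. b differentiable (at \<theta>) \<and> deriv b differentiable (at \<theta>)) \<and>
     strictly_convex_on (nat_params \<xi>) b"

definition expfam :: "real measure \<Rightarrow> (real \<Rightarrow> real) \<Rightarrow> real measure set" where
  "expfam \<xi> b = expfam_dist \<xi> b ` nat_params \<xi>"

definition mean :: "real measure \<Rightarrow> real" where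
  "mean \<nu> = (\<integral>x. x \<partial>\<nu>)"

definition mean_range :: "real measure \<Rightarrow> (real \<Rightarrow> real) \<Rightarrow> real set" where
  "mean_range \<xi> b = mean ` expfam \<xi> b"

definition mean_lower :: "real measure \<Rightarrow> (real \<Rightarrow> real) \<Rightarrow> ereal" where
  "mean_lower \<xi> b = (INF \<mu>\<in>mean_range \<xi> b. ereal \<mu>)"

definition mean_upper :: "real measure \<Rightarrow> (real \<Rightarrow> real) \<Rightarrow> ereal" where
  "mean_upper \<xi> b = (SUP \<mu>\<in>mean_range \<xi> b. ereal \<mu>)"

definition param_of_mean :: "real measure \<Rightarrow> (real \<Rightarrow> real) \<Rightarrow> real \<Rightarrow> real" where
  "param_of_mean \<xi> b = the_inv_into (nat_params \<xi>) (deriv b)"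

text \<open>
  The library writes \<open>KL_divergence c M N\<close> for the divergence of \<open>N\<close> from \<open>M\<close>, i.e. the integral
  of \<open>log c (dN/dM)\<close> with respect to \<open>N\<close>; hence the swapped arguments below. On the
  mean range \<open>kl_mean \<xi> b \<mu> \<mu>'\<close> is the Bregman divergence \<open>b t' - b t - deriv b t * (t' - t)\<close>
  where \<open>t = param_of_mean \<xi> b \<mu>\<close> and \<open>t' = param_of_mean \<xi> b \<mu>'\<close>.
\<close>
definition kl_mean :: "real measure \<Rightarrow> (real \<Rightarrow> real) \<Rightarrow> real \<Rightarrow> real \<Rightarrow> real" where
  "kl_mean \<xi> b \<mu> \<mu>' =
     KL_divergence (exp 1) (expfam_dist \<xi> b (param_of_mean \<xi> b \<mu>'))
       (expfam_dist \<xi> b (param_of_mean \<xi> b \<mu>))"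

section \<open>Confidence-interval policies\<close>

text \<open>
  The sample \<open>X\<^sub>1, X\<^sub>2, \<dots>\<close> is the coordinate process of an infinite product space, with
  \<open>X\<^sub>i\<close> stored at index \<open>i - 1\<close>. A policy is a pair of endpoint functions of the sample
  size, the confidence parameter and the first \<open>n\<close> observations.
\<close>
type_synonym endpoint = "nat \<Rightarrow> real \<Rightarrow> (nat \<Rightarrow> real) \<Rightarrow> ereal"
type_synonym policy = "endpoint \<times> endpoint"

definition iid :: "real measure \<Rightarrow> (nat \<Rightarrow> real) measure" where
  "iid \<nu> = (\<Pi>\<^sub>M i\<in>(UNIV :: nat set). \<nu>)"

definition ci_lower :: "policy \<Rightarrow> nat \<Rightarrow> real \<Rightarrow> (nat \<Rightarrow> real) \<Rightarrow> ereal" where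
  "ci_lower \<pi> n \<delta> \<omega> = fst \<pi> n \<delta> (restrict \<omega> {..<n})"

definition ci_upper :: "policy \<Rightarrow> nat \<Rightarrow> real \<Rightarrow> (nat \<Rightarrow> real) \<Rightarrow> ereal" where
  "ci_upper \<pi> n \<delta> \<omega> = snd \<pi> n \<delta> (restrict \<omega> {..<n})"

text \<open>
  The intervals produced by a policy lie in the closed hull of the mean range: a confidence
  interval is a set of candidate values of the mean. Without this convention the
  constant interval from \<open>-\<infinity>\<close> to \<open>\<infinity>\<close> would be a stable policy whose endpoints need
  not converge to the endpoints of the mean range.
\<close>
definition policies :: "real measure \<Rightarrow> (real \<Rightarrow> real) \<Rightarrow> policy set" where
  "policies \<xi> b = {\<pi>. \<forall>n\<ge>1. \<forall>\<delta>\<in>{0<..<1}.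
     fst \<pi> n \<delta> \<in> borel_measurable (\<Pi>\<^sub>M i\<in>{..<n}. borel) \<and>
     snd \<pi> n \<delta> \<in> borel_measurable (\<Pi>\<^sub>M i\<in>{..<n}. borel) \<and>
     (\<forall>\<omega>. {ci_lower \<pi> n \<delta> \<omega>..ci_upper \<pi> n \<delta> \<omega>} \<subseteq> {mean_lower \<xi> b..mean_upper \<xi> b})}"

definition ci_policies :: "real measure \<Rightarrow> (real \<Rightarrow> real) \<Rightarrow> policy set" where
  "ci_policies \<xi> b = {\<pi> \<in> policies \<xi> b. \<forall>\<nu>\<in>expfam \<xi> b. \<forall>\<delta>\<in>{0<..<1}. \<forall>n\<ge>1.
     measure (iid \<nu>) {\<omega> \<in> space (iid \<nu>).
       ereal (mean \<nu>) \<in> {ci_lower \<pi> n \<delta> \<omega>..ci_upper \<pi> n \<delta> \<omega>}} \<ge> 1 - \<delta>}"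

section \<open>Stability\<close>

text \<open>
  Convergence in probability, as \<open>\<delta>\<close> decreases to 0, to a constant that may be infinite: every
  neighbourhood of the constant is hit with probability tending to 1. For a finite constant \<open>c\<close>
  this is the usual condition that the probability of \<open>\<bar>Z \<delta> - c\<bar> \<ge> \<epsilon>\<close> tends to 0
  for every \<open>\<epsilon> > 0\<close>.
\<close>
definition conv_in_prob :: "'a measure \<Rightarrow> (real \<Rightarrow> 'a \<Rightarrow> ereal) \<Rightarrow> ereal \<Rightarrow> bool" where
  "conv_in_prob M Z c \<longleftrightarrow> (\<forall>U. open U \<and> c \<in> U \<longrightarrow>
     ((\<lambda>\<delta>. measure M {\<omega> \<in> space M. Z \<delta> \<omega> \<in> U}) \<longlongrightarrow> 1) (at_right 0))"

definition limiting_endpoints ::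
  "real measure \<Rightarrow> (real \<Rightarrow> nat) \<Rightarrow> policy \<Rightarrow> ereal \<Rightarrow> ereal \<Rightarrow> bool" where
  "limiting_endpoints \<nu> N \<pi> \<mu>L \<mu>R \<longleftrightarrow>
     \<mu>L \<le> ereal (mean \<nu>) \<and> ereal (mean \<nu>) \<le> \<mu>R \<and>
     conv_in_prob (iid \<nu>) (\<lambda>\<delta>. ci_lower \<pi> (N \<delta>) \<delta>) \<mu>L \<and>
     conv_in_prob (iid \<nu>) (\<lambda>\<delta>. ci_upper \<pi> (N \<delta>) \<delta>) \<mu>R"

definition sample_rate :: "(real \<Rightarrow> nat) \<Rightarrow> ereal \<Rightarrow> bool" where
  "sample_rate N k \<longleftrightarrow> ((\<lambda>\<delta>. ereal (real (N \<delta>) / ln (1 / \<delta>))) \<longlongrightarrow> k) (at_right 0)"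

definition stable_ci_policies ::
  "real measure \<Rightarrow> (real \<Rightarrow> real) \<Rightarrow> real measure \<Rightarrow> (real \<Rightarrow> nat) \<Rightarrow> policy set" where
  "stable_ci_policies \<xi> b \<nu> N = {\<pi> \<in> ci_policies \<xi> b.
     (\<exists>k\<in>{0..\<infinity>}. sample_rate N k) \<longrightarrow> (\<exists>\<mu>L \<mu>R. limiting_endpoints \<nu> N \<pi> \<mu>L \<mu>R)}"

section \<open>Optimal limiting endpoints\<close>

definition upper_solution :: "real measure \<Rightarrow> (real \<Rightarrow> real) \<Rightarrow> real \<Rightarrow> real \<Rightarrow> real \<Rightarrow> bool" where
  "upper_solution \<xi> b \<mu> k m \<longleftrightarrow> m \<in> mean_range \<xi> b \<and> m > \<mu> \<and> kl_mean \<xi> b \<mu> m = 1 / k"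

definition lower_solution :: "real measure \<Rightarrow> (real \<Rightarrow> real) \<Rightarrow> real \<Rightarrow> real \<Rightarrow> real \<Rightarrow> bool" where
  "lower_solution \<xi> b \<mu> k m \<longleftrightarrow> m \<in> mean_range \<xi> b \<and> m < \<mu> \<and> kl_mean \<xi> b \<mu> m = 1 / k"

text \<open>
  The divergence may be bounded on one side of \<open>\<mu>\<close>: the density \<open>x powr -2\<close> on \<open>{1..}\<close> gives a
  family with mean range \<open>{1<..}\<close> for which \<open>kl_mean \<xi> b \<mu>\<close> is bounded on \<open>{\<mu><..}\<close>. When the
  level \<open>1 / k\<close> is not attained on a side, every mean on that side is
  closer to \<open>\<mu>\<close> than \<open>1 / k\<close>, and the corresponding value is the endpoint of the mean range.
\<close>
definition mu_R_star :: "real measure \<Rightarrow> (real \<Rightarrow> real) \<Rightarrow> real \<Rightarrow> real \<Rightarrow> ereal" where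
  "mu_R_star \<xi> b \<mu> k =
     (if \<exists>m. upper_solution \<xi> b \<mu> k m then ereal (THE m. upper_solution \<xi> b \<mu> k m)
      else mean_upper \<xi> b)"

definition mu_L_star :: "real measure \<Rightarrow> (real \<Rightarrow> real) \<Rightarrow> real \<Rightarrow> real \<Rightarrow> ereal" where
  "mu_L_star \<xi> b \<mu> k =
     (if \<exists>m. lower_solution \<xi> b \<mu> k m then ereal (THE m. lower_solution \<xi> b \<mu> k m)
      else mean_lower \<xi> b)"

end

theory Submission
  imports Defs
begin

text \<open>
  The theorem is a change-of-measure lower bound. Let the data come from the member of the family
  with parameter \<open>\<theta>\<close> and mean \<open>\<mu>\<close>, and suppose that the upper endpoint converged to a limit below
  the mean \<open>m'\<close> of some other member \<open>\<theta>'\<close>. Then the event "upper endpoint below \<open>m'\<close>" has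
  probability tending to 1 under \<open>\<theta>\<close>, whereas coverage at \<open>\<theta>'\<close> forces its probability under
  \<open>\<theta>'\<close> to be at most \<open>\<delta>\<close>. The log-likelihood ratio of \<open>n\<close> observations is about
  \<open>n * d(\<mu>, m')\<close> under \<open>\<theta>\<close>, so the two probabilities can differ by a factor of at most about
  \<open>exp (n * d(\<mu>, m'))\<close>. Hence \<open>ln (1 / \<delta>)\<close> is at most about \<open>N \<delta> * d(\<mu>, m')\<close>, and in the
  limit \<open>1 \<le> k * d(\<mu>, m')\<close>. This is \<open>sample_rate_lower_bound\<close> for general events and
  \<open>endpoint_limit_bound\<close> for the endpoints. Read backwards: every mean with \<open>k * d(\<mu>, m') < 1\<close>
  lies between the two limits. For \<open>k = 0\<close> these are all the means; for \<open>k > 0\<close> they fill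
  the open interval between the two optimal endpoints, because \<open>d(\<mu>, \<cdot>)\<close> increases strictly and
  continuously away from \<open>\<mu>\<close>.

  Two devices keep the argument elementary. First, the law of large numbers for the log-likelihood
  ratio comes from the change of measure itself: tilting \<open>\<theta>\<close> by a small
  amount in the direction of the deviation gives an exponential bound (\<open>llr_concentrates\<close>), whose rate is negative
  because \<open>b\<close> is differentiable. Second, the identity between the mean and \<open>deriv b\<close>
  needs no differentiation under the integral: nonnegativity of the divergence says that the mean is a
  slope of a line supporting \<open>b\<close> at \<open>\<theta>\<close> (\<open>tangent_at_mean\<close>), and a differentiable function has only one.

  In the no-learning regime the limits must also stay inside the hull of the mean range. An
  interval reaching outside the hull is empty by the definition of a policy, hence misses the true mean,
  which is rare; the same lower bound with \<open>\<theta>' = \<theta>\<close>, where the divergence vanishes, turns this into a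
  contradiction.
\<close>

section \<open>Product measures\<close>

lemma PiM_density:
  assumes "finite I" and M: "prob_space M" and D: "prob_space (density M r)"
    and [measurable]: "r \<in> borel_measurable M"
  shows "(\<Pi>\<^sub>M i\<in>I. density M r) = density (\<Pi>\<^sub>M i\<in>I. M) (\<lambda>\<omega>. \<Prod>i\<in>I. r (\<omega> i))"
proof -
  interpret M: product_sigma_finite "\<lambda>_. M"
    using M by (simp add: product_sigma_finite_def prob_space_imp_sigma_finite)
  interpret D: product_sigma_finite "\<lambda>_. density M r"
    using D by (simp add: product_sigma_finite_def prob_space_imp_sigma_finite)
  have sets_eq: "sets (\<Pi>\<^sub>M i\<in>I. density M r) = sets (\<Pi>\<^sub>M i\<in>I. M)"
    by (intro sets_PiM_cong) auto
  have "density (\<Pi>\<^sub>M i\<in>I. M) (\<lambda>\<omega>. \<Prod>i\<in>I. r (\<omega> i)) = (\<Pi>\<^sub>M i\<in>I. density M r)"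
  proof (rule D.PiM_eqI[OF \<open>finite I\<close>])
    fix A assume "\<And>i. i \<in> I \<Longrightarrow> A i \<in> sets (density M r)"
    then have A[measurable]: "\<And>i. i \<in> I \<Longrightarrow> A i \<in> sets M" by simp
    \<comment> \<open>On a box the indicator factorises, so both measures reduce to the same product of integrals.\<close>
    have ind: "indicator (Pi\<^sub>E I A) \<omega> = (\<Prod>i\<in>I. indicator (A i) (\<omega> i) :: ennreal)"
      if "\<omega> \<in> space (\<Pi>\<^sub>M i\<in>I. M)" for \<omega>
    proof (cases "\<omega> \<in> Pi\<^sub>E I A")
      case False
      with that obtain i where "i \<in> I" "\<omega> i \<notin> A i"
        by (auto simp: space_PiM PiE_iff)
      with False show ?thesis
        using \<open>finite I\<close> by (auto simp: prod_zero_iff intro!: bexI[of _ i])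
    qed (auto simp: PiE_iff)
    have "emeasure (density (\<Pi>\<^sub>M i\<in>I. M) (\<lambda>\<omega>. \<Prod>i\<in>I. r (\<omega> i))) (Pi\<^sub>E I A) =
        (\<integral>\<^sup>+\<omega>. (\<Prod>i\<in>I. r (\<omega> i)) * indicator (Pi\<^sub>E I A) \<omega> \<partial>(\<Pi>\<^sub>M i\<in>I. M))"
      using A \<open>finite I\<close> by (intro emeasure_density) (auto intro!: sets_PiM_I_finite)
    also have "\<dots> = (\<integral>\<^sup>+\<omega>. (\<Prod>i\<in>I. r (\<omega> i) * indicator (A i) (\<omega> i)) \<partial>(\<Pi>\<^sub>M i\<in>I. M))"
      by (intro nn_integral_cong) (simp add: ind prod.distrib)
    also have "\<dots> = (\<Prod>i\<in>I. \<integral>\<^sup>+x. r x * indicator (A i) x \<partial>M)"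
      using \<open>finite I\<close>
      by (intro M.product_nn_integral_prod[where f="\<lambda>i x. r x * indicator (A i) x"]) simp_all
    also have "\<dots> = (\<Prod>i\<in>I. emeasure (density M r) (A i))"
      using A by (intro prod.cong refl) (simp add: emeasure_density)
    finally show "emeasure (density (\<Pi>\<^sub>M i\<in>I. M) (\<lambda>\<omega>. \<Prod>i\<in>I. r (\<omega> i))) (Pi\<^sub>E I A) =
        (\<Prod>i\<in>I. emeasure (density M r) (A i))" .
  qed (simp add: sets_eq)
  then show ?thesis by simp
qed

text \<open>
  An event that depends on the first observations only can be evaluated in a finite product, where a
  likelihood ratio exists; two infinite products of distinct members of the family have none.
\<close>
lemma measure_iid_restrict:
  assumes "prob_space \<nu>" and "sets \<nu> = sets borel"
    and A: "A \<in> sets (\<Pi>\<^sub>M i\<in>{..<n}. (borel :: real measure))"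
  shows "{\<omega> \<in> space (iid \<nu>). restrict \<omega> {..<n} \<in> A} \<in> sets (iid \<nu>)"
    and "measure (iid \<nu>) {\<omega> \<in> space (iid \<nu>). restrict \<omega> {..<n} \<in> A} =
      measure (\<Pi>\<^sub>M i\<in>{..<n}. \<nu>) A"
proof -
  interpret product_prob_space "\<lambda>_. \<nu>" "UNIV :: nat set"
    using assms(1)
    by (simp add: product_prob_space_def product_prob_space_axioms_def product_sigma_finite_def
        prob_space_imp_sigma_finite)
  have A': "A \<in> sets (\<Pi>\<^sub>M i\<in>{..<n}. \<nu>)"
    using A assms(2) by (simp cong: sets_PiM_cong)
  have res[measurable]: "(\<lambda>\<omega>. restrict \<omega> {..<n}) \<in> measurable (iid \<nu>) (\<Pi>\<^sub>M i\<in>{..<n}. \<nu>)"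
    unfolding iid_def by (intro measurable_restrict_subset) auto
  show "{\<omega> \<in> space (iid \<nu>). restrict \<omega> {..<n} \<in> A} \<in> sets (iid \<nu>)"
    using A' by measurable
  have "measure (\<Pi>\<^sub>M i\<in>{..<n}. \<nu>) A =
      measure (distr (iid \<nu>) (\<Pi>\<^sub>M i\<in>{..<n}. \<nu>) (\<lambda>\<omega>. restrict \<omega> {..<n})) A"
    unfolding iid_def by (subst distr_PiM_restrict_finite) auto
  also have "\<dots> = measure (iid \<nu>) {\<omega> \<in> space (iid \<nu>). restrict \<omega> {..<n} \<in> A}"
    using A' res by (subst measure_distr) (auto intro!: arg_cong[where f="measure (iid \<nu>)"])
  finally show "measure (iid \<nu>) {\<omega> \<in> space (iid \<nu>). restrict \<omega> {..<n} \<in> A} =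
      measure (\<Pi>\<^sub>M i\<in>{..<n}. \<nu>) A" ..
qed

section \<open>Mean and divergence in an exponential family\<close>

locale canonical_family =
  fixes \<xi> :: "real measure" and b :: "real \<Rightarrow> real"
  assumes family: "exponential_family \<xi> b"
begin

abbreviation "\<Theta> \<equiv> nat_params \<xi>"
abbreviation "P \<equiv> expfam_dist \<xi> b"

text \<open>
  The divergence of the family in its natural parameters; \<open>kl_mean_eq\<close> below identifies it with
  \<open>kl_mean\<close>. All estimates are made in these coordinates.
\<close>
definition bregman :: "real \<Rightarrow> real \<Rightarrow> real" where
  "bregman \<theta> \<theta>' = b \<theta>' - b \<theta> - deriv b \<theta> * (\<theta>' - \<theta>)"

lemma sets_base [measurable_cong, simp]: "sets \<xi> = sets borel"
  using family by (simp add: exponential_family_def)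

lemma space_base [simp]: "space \<xi> = UNIV"
  using sets_eq_imp_space_eq[OF sets_base] by simp

lemma sets_P [measurable_cong, simp]: "sets (P \<theta>) = sets borel"
  by (simp add: expfam_dist_def)

lemma prob_space_P: "\<theta> \<in> \<Theta> \<Longrightarrow> prob_space (P \<theta>)"
  using family by (simp add: exponential_family_def)

lemma open_params: "open \<Theta>"
  using family by (simp add: exponential_family_def)

lemma params_between:
  assumes "\<theta> \<in> \<Theta>" "\<theta>' \<in> \<Theta>" "\<theta> \<le> t" "t \<le> \<theta>'"
  shows "t \<in> \<Theta>"
  using family assms unfolding exponential_family_def is_interval_1 by blast

lemma DERIV_b: "\<theta> \<in> \<Theta> \<Longrightarrow> (b has_real_derivative deriv b \<theta>) (at \<theta>)"
  using family by (simp add: exponential_family_def DERIV_deriv_iff_real_differentiable)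

lemma isCont_b: "\<theta> \<in> \<Theta> \<Longrightarrow> isCont b \<theta>"
  using DERIV_b DERIV_isCont by blast

lemma isCont_deriv_b: "\<theta> \<in> \<Theta> \<Longrightarrow> isCont (deriv b) \<theta>"
  using family by (auto simp: exponential_family_def intro: differentiable_imp_continuous_within)

lemma P_eq_density_P:
  "P \<theta> = density (P \<theta>') (\<lambda>x. ennreal (exp ((\<theta> - \<theta>') * x - (b \<theta> - b \<theta>'))))"
  unfolding expfam_dist_def
  by (subst density_density_eq)
    (auto simp: ennreal_mult'[symmetric] exp_add[symmetric] algebra_simps)

text \<open>
  This is where the factor \<open>\<bar>x\<bar>\<close> in the definition of the natural parameters enters.
\<close>
lemma integrable_P: "\<theta> \<in> \<Theta> \<Longrightarrow> integrable (P \<theta>) (\<lambda>x. x)"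
proof -
  assume \<theta>: "\<theta> \<in> \<Theta>"
  have fin: "(\<integral>\<^sup>+x. ennreal (\<bar>x\<bar> * exp (\<theta> * x)) \<partial>\<xi>) < \<infinity>"
    using \<theta> by (simp add: nat_params_def)
  have "integrable \<xi> (\<lambda>x. x * exp (\<theta> * x))"
    using fin by (intro integrableI_bounded) (auto simp: abs_mult)
  then have "integrable \<xi> (\<lambda>x. exp (- b \<theta>) * (x * exp (\<theta> * x)))"
    by (rule integrable_mult_right)
  then show ?thesis
    unfolding expfam_dist_def
    by (subst integrable_real_density) (auto simp: exp_diff exp_minus field_simps)
qed

text \<open>
  Gibbs' inequality: the density of \<open>P \<theta>'\<close> with respect to \<open>P \<theta>\<close> is \<open>exp\<close> of an affine function of the
  observation and has integral 1. Integrating \<open>1 + y \<le> exp y\<close> gives the claim.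
\<close>
lemma tangent_at_mean:
  assumes "\<theta> \<in> \<Theta>" "\<theta>' \<in> \<Theta>"
  shows "mean (P \<theta>) * (\<theta>' - \<theta>) \<le> b \<theta>' - b \<theta>"
proof -
  interpret P: prob_space "P \<theta>" by (rule prob_space_P[OF assms(1)])
  interpret P': prob_space "P \<theta>'" by (rule prob_space_P[OF assms(2)])
  let ?l = "\<lambda>x. (\<theta>' - \<theta>) * x - (b \<theta>' - b \<theta>)"
  have dens: "P \<theta>' = density (P \<theta>) (\<lambda>x. ennreal (exp (?l x)))"
    by (rule P_eq_density_P)
  have nn: "(\<integral>\<^sup>+x. ennreal (exp (?l x)) \<partial>P \<theta>) = 1"
    using P'.emeasure_space_1 unfolding dens
    by (subst (asm) emeasure_density) (auto simp: expfam_dist_def)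
  have int: "integrable (P \<theta>) (\<lambda>x. exp (?l x))"
    by (rule integrableI_bounded) (auto simp: nn)
  have one: "(\<integral>x. exp (?l x) \<partial>P \<theta>) = 1"
    using nn_integral_eq_integral[OF int] nn by simp
  have "(\<integral>x. 1 + ?l x \<partial>P \<theta>) \<le> (\<integral>x. exp (?l x) \<partial>P \<theta>)"
    using integrable_P[OF assms(1)] int by (intro integral_mono) (auto simp: exp_ge_add_one_self)
  also have "(\<integral>x. 1 + ?l x \<partial>P \<theta>) = 1 + (\<theta>' - \<theta>) * mean (P \<theta>) - (b \<theta>' - b \<theta>)"
    using integrable_P[OF assms(1)] P.prob_space by (simp add: mean_def algebra_simps)
  finally show ?thesis using one by (simp add: algebra_simps)
qed

text \<open>
  By \<open>tangent_at_mean\<close> the function \<open>t \<mapsto> b t - mean (P \<theta>) * t\<close> has a minimum at the interior point \<open>\<theta>\<close>, so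
  its derivative vanishes there.
\<close>
lemma mean_P:
  assumes "\<theta> \<in> \<Theta>"
  shows "mean (P \<theta>) = deriv b \<theta>"
proof -
  obtain e where e: "e > 0" "ball \<theta> e \<subseteq> \<Theta>"
    using open_params assms openE by blast
  have "((\<lambda>t. b t - mean (P \<theta>) * t) has_real_derivative deriv b \<theta> - mean (P \<theta>)) (at \<theta>)"
    by (auto intro!: derivative_eq_intros DERIV_b assms)
  moreover have "b \<theta> - mean (P \<theta>) * \<theta> \<le> b t - mean (P \<theta>) * t" if "\<bar>\<theta> - t\<bar> < e" for t
    using tangent_at_mean[OF assms, of t] e that by (auto simp: dist_real_def algebra_simps)
  ultimately have "deriv b \<theta> - mean (P \<theta>) = 0"
    using e(1) by (intro DERIV_local_min) auto
  then show ?thesis by simp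
qed

text \<open>
  The graph of \<open>b\<close> lies above its tangent at \<open>\<theta>\<close>; if it touched the tangent at \<open>\<theta>'\<close>, strict convexity
  would put it below the tangent at the midpoint.
\<close>
lemma bregman_pos:
  assumes "\<theta> \<in> \<Theta>" "\<theta>' \<in> \<Theta>" "\<theta> \<noteq> \<theta>'"
  shows "bregman \<theta> \<theta>' > 0"
proof -
  let ?m = "(1/2) * \<theta> + (1 - 1/2) * \<theta>'"
  have conv: "strictly_convex_on \<Theta> b"
    using family by (simp add: exponential_family_def)
  have "\<forall>u\<in>{0<..<1}. b (u * \<theta> + (1 - u) * \<theta>') < u * b \<theta> + (1 - u) * b \<theta>'"
    using conv assms unfolding strictly_convex_on_def by blast
  then have mid: "b ?m < (1/2) * b \<theta> + (1 - 1/2) * b \<theta>'"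
    by (rule bspec) auto
  have "?m \<in> \<Theta>"
    using params_between[of \<theta> \<theta>' ?m] params_between[of \<theta>' \<theta> ?m] assms by (cases "\<theta> \<le> \<theta>'") auto
  then have "deriv b \<theta> * (?m - \<theta>) \<le> b ?m - b \<theta>"
    using tangent_at_mean[of \<theta> ?m] mean_P assms by simp
  with mid show ?thesis by (simp add: bregman_def algebra_simps)
qed

text \<open>
  The three-point identity of Bregman divergences.
\<close>
lemma bregman_add:
  "bregman \<theta> \<theta>'' = bregman \<theta> \<theta>' + bregman \<theta>' \<theta>'' + (deriv b \<theta>' - deriv b \<theta>) * (\<theta>'' - \<theta>')"
  by (simp add: bregman_def algebra_simps)

text \<open>
  The symmetrised divergence of \<open>s\<close> and \<open>t\<close> equals \<open>(deriv b t - deriv b s) * (t - s)\<close>, and it is positive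
  when \<open>s \<noteq> t\<close>.
\<close>
lemma deriv_b_less_iff:
  assumes "\<theta> \<in> \<Theta>" "\<theta>' \<in> \<Theta>"
  shows "deriv b \<theta> < deriv b \<theta>' \<longleftrightarrow> \<theta> < \<theta>'"
proof -
  have less: "deriv b s < deriv b t" if "s \<in> \<Theta>" "t \<in> \<Theta>" "s < t" for s t
  proof -
    have "(deriv b t - deriv b s) * (t - s) = bregman s t + bregman t s"
      by (simp add: bregman_def algebra_simps)
    also have "\<dots> > 0"
      using bregman_pos[of s t] bregman_pos[of t s] that by simp
    finally show ?thesis using that by (simp add: zero_less_mult_iff)
  qed
  show ?thesis using less[of \<theta> \<theta>'] less[of \<theta>' \<theta>] assms by (cases \<theta> \<theta>' rule: linorder_cases) auto
qed

lemma inj_on_deriv_b: "inj_on (deriv b) \<Theta>"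
  by (rule inj_onI) (metis deriv_b_less_iff linorder_neq_iff)

text \<open>
  In \<open>bregman_add\<close> the last two terms are positive when \<open>\<theta>'\<close> lies strictly between \<open>\<theta>\<close> and \<open>\<theta>''\<close>.
\<close>
lemma bregman_strict_mono:
  assumes "\<theta> \<in> \<Theta>" "\<theta>' \<in> \<Theta>" "\<theta>'' \<in> \<Theta>"
    and "\<theta> < \<theta>' \<and> \<theta>' < \<theta>'' \<or> \<theta>'' < \<theta>' \<and> \<theta>' < \<theta>"
  shows "bregman \<theta> \<theta>' < bregman \<theta> \<theta>''"
proof -
  have "(deriv b \<theta>' - deriv b \<theta>) * (\<theta>'' - \<theta>') > 0"
    using assms deriv_b_less_iff by (auto simp: zero_less_mult_iff)
  moreover have "bregman \<theta>' \<theta>'' > 0"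
    using assms by (intro bregman_pos) auto
  ultimately show ?thesis using bregman_add[of \<theta> \<theta>'' \<theta>'] by simp
qed

lemma bregman_inj:
  assumes "\<theta> \<in> \<Theta>" "s \<in> \<Theta>" "t \<in> \<Theta>"
    and "\<theta> < s \<and> \<theta> < t \<or> s < \<theta> \<and> t < \<theta>" and eq: "bregman \<theta> s = bregman \<theta> t"
  shows "s = t"
proof (rule ccontr)
  assume "s \<noteq> t"
  then consider "\<theta> < s \<and> s < t \<or> t < s \<and> s < \<theta>" | "\<theta> < t \<and> t < s \<or> s < t \<and> t < \<theta>"
    using assms(4) by linarith
  then show False
    using bregman_strict_mono[OF assms(1,2,3)] bregman_strict_mono[OF assms(1,3,2)] eq by cases auto
qed

lemma mean_range_eq: "mean_range \<xi> b = deriv b ` \<Theta>"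
  by (auto simp: mean_range_def expfam_def image_image mean_P)

lemma kl_mean_eq:
  assumes "\<theta> \<in> \<Theta>" "\<theta>' \<in> \<Theta>"
  shows "kl_mean \<xi> b (deriv b \<theta>) (deriv b \<theta>') = bregman \<theta> \<theta>'"
proof -
  interpret P': prob_space "P \<theta>'" by (rule prob_space_P[OF assms(2)])
  interpret P: prob_space "P \<theta>" by (rule prob_space_P[OF assms(1)])
  have inv: "param_of_mean \<xi> b (deriv b t) = t" if "t \<in> \<Theta>" for t
    using inj_on_deriv_b that by (simp add: param_of_mean_def the_inv_into_f_f)
  let ?r = "\<lambda>x. exp ((\<theta> - \<theta>') * x - (b \<theta> - b \<theta>'))"
  have "kl_mean \<xi> b (deriv b \<theta>) (deriv b \<theta>') = KL_divergence (exp 1) (P \<theta>') (density (P \<theta>') ?r)"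
    using assms by (simp add: kl_mean_def inv P_eq_density_P[of \<theta> \<theta>', symmetric])
  also have "\<dots> = (\<integral>x. ?r x * log (exp 1) (?r x) \<partial>P \<theta>')"
    by (rule P'.KL_density) (auto simp: expfam_dist_def)
  also have "\<dots> = (\<integral>x. (\<theta> - \<theta>') * x - (b \<theta> - b \<theta>') \<partial>density (P \<theta>') ?r)"
    by (subst integral_real_density) (auto simp: log_def)
  also have "\<dots> = (\<integral>x. (\<theta> - \<theta>') * x - (b \<theta> - b \<theta>') \<partial>P \<theta>)"
    by (simp add: P_eq_density_P[of \<theta> \<theta>', symmetric])
  also have "\<dots> = (\<theta> - \<theta>') * mean (P \<theta>) - (b \<theta> - b \<theta>')"
    using integrable_P[OF assms(1)] P.prob_space by (simp add: mean_def)
  also have "\<dots> = bregman \<theta> \<theta>'"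
    using mean_P[OF assms(1)] by (simp add: bregman_def algebra_simps)
  finally show ?thesis .
qed

lemma deriv_b_between:
  assumes "\<theta> \<in> \<Theta>" "\<theta>' \<in> \<Theta>" "deriv b \<theta> < y" "y < deriv b \<theta>'"
  obtains t where "t \<in> \<Theta>" "\<theta> < t" "t < \<theta>'" "deriv b t = y"
proof -
  have "\<theta> < \<theta>'" using deriv_b_less_iff[OF assms(1,2)] assms(3,4) by simp
  moreover have "\<forall>x. \<theta> \<le> x \<and> x \<le> \<theta>' \<longrightarrow> isCont (deriv b) x"
    using isCont_deriv_b params_between[OF assms(1,2)] by blast
  ultimately obtain t where t: "\<theta> \<le> t" "t \<le> \<theta>'" "deriv b t = y"
    using IVT[of "deriv b" \<theta> y \<theta>'] assms(3,4) by auto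
  then have "t \<in> \<Theta>" using params_between assms by blast
  moreover have "t \<noteq> \<theta>" "t \<noteq> \<theta>'" using assms t by auto
  ultimately show thesis using that t by (simp add: less_le)
qed

lemma bregman_attains:
  assumes "\<theta> \<in> \<Theta>" "\<theta>' \<in> \<Theta>" "0 < c" "c \<le> bregman \<theta> \<theta>'"
  obtains t where "t \<in> closed_segment \<theta> \<theta>'" "t \<in> \<Theta>" "bregman \<theta> t = c"
proof -
  have sub: "closed_segment \<theta> \<theta>' \<subseteq> \<Theta>"
    using params_between[OF assms(1,2)] params_between[OF assms(2,1)]
    by (auto simp: closed_segment_eq_real_ivl split: if_splits)
  have "continuous_on (closed_segment \<theta> \<theta>') (bregman \<theta>)"
    unfolding bregman_def[abs_def]
    using sub by (intro continuous_intros continuous_at_imp_continuous_on) (auto intro: isCont_b)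
  then have "connected (bregman \<theta> ` closed_segment \<theta> \<theta>')"
    by (intro connected_continuous_image) auto
  moreover have "bregman \<theta> \<theta> \<in> bregman \<theta> ` closed_segment \<theta> \<theta>'"
    "bregman \<theta> \<theta>' \<in> bregman \<theta> ` closed_segment \<theta> \<theta>'"
    by (rule imageI, simp)+
  moreover have "bregman \<theta> \<theta> \<le> c" using assms(3) by (simp add: bregman_def)
  ultimately have "c \<in> bregman \<theta> ` closed_segment \<theta> \<theta>'"
    using assms(4) by (rule connectedD_interval)
  then show thesis using that sub by auto
qed

text \<open>
  If some mean above \<open>deriv b \<theta>\<close> is at divergence at least \<open>1 / k\<close>, the intermediate value theorem
  yields a solution, and strict monotonicity makes it the only one.
\<close>
lemma upper_solution_alternative:
  assumes "\<theta> \<in> \<Theta>" "k > 0"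
  shows "(\<exists>!m. upper_solution \<xi> b (deriv b \<theta>) k m) \<or>
    (\<forall>m\<in>mean_range \<xi> b. m > deriv b \<theta> \<longrightarrow> kl_mean \<xi> b (deriv b \<theta>) m < 1 / k)"
proof (rule disjCI)
  assume "\<not> (\<forall>m\<in>mean_range \<xi> b. m > deriv b \<theta> \<longrightarrow> kl_mean \<xi> b (deriv b \<theta>) m < 1 / k)"
  then obtain \<theta>' where \<theta>': "\<theta>' \<in> \<Theta>" "deriv b \<theta> < deriv b \<theta>'" "1 / k \<le> bregman \<theta> \<theta>'"
    using assms by (auto simp: mean_range_eq kl_mean_eq not_less)
  then obtain t where t: "t \<in> closed_segment \<theta> \<theta>'" "t \<in> \<Theta>" "bregman \<theta> t = 1 / k"
    using bregman_attains[of \<theta> \<theta>' "1 / k"] assms by auto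
  have "\<theta> < \<theta>'" using \<theta>' deriv_b_less_iff assms by auto
  moreover have "t \<noteq> \<theta>" using t assms(2) by (auto simp: bregman_def)
  ultimately have "\<theta> < t" using t(1) by (auto simp: closed_segment_eq_real_ivl)
  show "\<exists>!m. upper_solution \<xi> b (deriv b \<theta>) k m"
  proof (rule ex1I)
    show "upper_solution \<xi> b (deriv b \<theta>) k (deriv b t)"
      using t \<open>\<theta> < t\<close> assms by (simp add: upper_solution_def mean_range_eq kl_mean_eq deriv_b_less_iff)
  next
    fix m assume "upper_solution \<xi> b (deriv b \<theta>) k m"
    then obtain s where s: "s \<in> \<Theta>" "m = deriv b s" "\<theta> < s" "bregman \<theta> s = 1 / k"
      using assms by (auto simp: upper_solution_def mean_range_eq kl_mean_eq deriv_b_less_iff)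
    then have "s = t"
      using bregman_inj[OF assms(1) s(1) t(2)] t(3) \<open>\<theta> < t\<close> by simp
    then show "m = deriv b t" using s(2) by simp
  qed
qed

lemma lower_solution_alternative:
  assumes "\<theta> \<in> \<Theta>" "k > 0"
  shows "(\<exists>!m. lower_solution \<xi> b (deriv b \<theta>) k m) \<or>
    (\<forall>m\<in>mean_range \<xi> b. m < deriv b \<theta> \<longrightarrow> kl_mean \<xi> b (deriv b \<theta>) m < 1 / k)"
proof (rule disjCI)
  assume "\<not> (\<forall>m\<in>mean_range \<xi> b. m < deriv b \<theta> \<longrightarrow> kl_mean \<xi> b (deriv b \<theta>) m < 1 / k)"
  then obtain \<theta>' where \<theta>': "\<theta>' \<in> \<Theta>" "deriv b \<theta>' < deriv b \<theta>" "1 / k \<le> bregman \<theta> \<theta>'"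
    using assms by (auto simp: mean_range_eq kl_mean_eq not_less)
  then obtain t where t: "t \<in> closed_segment \<theta> \<theta>'" "t \<in> \<Theta>" "bregman \<theta> t = 1 / k"
    using bregman_attains[of \<theta> \<theta>' "1 / k"] assms by auto
  have "\<theta>' < \<theta>" using \<theta>' deriv_b_less_iff assms by auto
  moreover have "t \<noteq> \<theta>" using t assms(2) by (auto simp: bregman_def)
  ultimately have "t < \<theta>" using t(1) by (auto simp: closed_segment_eq_real_ivl)
  show "\<exists>!m. lower_solution \<xi> b (deriv b \<theta>) k m"
  proof (rule ex1I)
    show "lower_solution \<xi> b (deriv b \<theta>) k (deriv b t)"
      using t \<open>t < \<theta>\<close> assms by (simp add: lower_solution_def mean_range_eq kl_mean_eq deriv_b_less_iff)
  next
    fix m assume "lower_solution \<xi> b (deriv b \<theta>) k m"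
    then obtain s where s: "s \<in> \<Theta>" "m = deriv b s" "s < \<theta>" "bregman \<theta> s = 1 / k"
      using assms by (auto simp: lower_solution_def mean_range_eq kl_mean_eq deriv_b_less_iff)
    then have "s = t"
      using bregman_inj[OF assms(1) s(1) t(2)] t(3) \<open>t < \<theta>\<close> by simp
    then show "m = deriv b t" using s(2) by simp
  qed
qed

section \<open>Change of measure\<close>

abbreviation sample :: "nat \<Rightarrow> real \<Rightarrow> (nat \<Rightarrow> real) measure" where
  "sample n \<theta> \<equiv> \<Pi>\<^sub>M i\<in>{..<n}. P \<theta>"

definition log_likelihood_ratio :: "nat \<Rightarrow> real \<Rightarrow> real \<Rightarrow> (nat \<Rightarrow> real) \<Rightarrow> real" where
  "log_likelihood_ratio n \<theta> \<theta>' \<omega> = (\<theta> - \<theta>') * (\<Sum>i<n. \<omega> i) - real n * (b \<theta> - b \<theta>')"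

lemma measurable_llr [measurable]:
  "log_likelihood_ratio n \<theta> \<theta>' \<in> borel_measurable (\<Pi>\<^sub>M i\<in>{..<n}. borel)"
  unfolding log_likelihood_ratio_def[abs_def] by measurable

lemma sets_sample [measurable_cong]: "sets (sample n \<theta>) = sets (\<Pi>\<^sub>M i\<in>{..<n}. borel)"
  by (intro sets_PiM_cong) auto

lemma prob_space_sample: "\<theta> \<in> \<Theta> \<Longrightarrow> prob_space (sample n \<theta>)"
  by (intro prob_space_PiM prob_space_P)

lemma sample_eq_density:
  assumes "\<theta> \<in> \<Theta>" "\<theta>' \<in> \<Theta>"
  shows "sample n \<theta> = density (sample n \<theta>') (\<lambda>\<omega>. ennreal (exp (log_likelihood_ratio n \<theta> \<theta>' \<omega>)))"
proof -
  let ?r = "\<lambda>x. ennreal (exp ((\<theta> - \<theta>') * x - (b \<theta> - b \<theta>')))"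
  have "sample n \<theta> = density (sample n \<theta>') (\<lambda>\<omega>. \<Prod>i<n. ?r (\<omega> i))"
    using PiM_density[of "{..<n}" "P \<theta>'" ?r] prob_space_P[OF assms(1)] prob_space_P[OF assms(2)]
    by (simp add: P_eq_density_P[of \<theta> \<theta>', symmetric])
  also have "(\<lambda>\<omega>. \<Prod>i<n. ?r (\<omega> i)) = (\<lambda>\<omega>. ennreal (exp (log_likelihood_ratio n \<theta> \<theta>' \<omega>)))"
    by (simp add: prod_ennreal exp_sum[symmetric] log_likelihood_ratio_def sum_subtractf
        sum_distrib_left)
  finally show ?thesis .
qed

text \<open>
  Where the log-likelihood ratio is at most \<open>c\<close>, the density of the first sample law with respect to the
  second is at most \<open>exp c\<close>. The bound serves twice: to transfer the error
  probability from \<open>\<theta>'\<close> to \<open>\<theta>\<close>, and for the Chernoff bound.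
\<close>
lemma change_of_measure:
  assumes "\<theta> \<in> \<Theta>" "\<theta>' \<in> \<Theta>" and A[measurable]: "A \<in> sets (\<Pi>\<^sub>M i\<in>{..<n}. borel)"
    and le: "\<And>\<omega>. \<omega> \<in> A \<Longrightarrow> log_likelihood_ratio n \<theta> \<theta>' \<omega> \<le> c"
  shows "measure (sample n \<theta>) A \<le> exp c * measure (sample n \<theta>') A"
proof -
  interpret S: prob_space "sample n \<theta>" by (rule prob_space_sample[OF assms(1)])
  interpret S': prob_space "sample n \<theta>'" by (rule prob_space_sample[OF assms(2)])
  have "emeasure (sample n \<theta>) A =
      (\<integral>\<^sup>+\<omega>. ennreal (exp (log_likelihood_ratio n \<theta> \<theta>' \<omega>)) * indicator A \<omega> \<partial>sample n \<theta>')"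
    by (subst sample_eq_density[OF assms(1,2)], subst emeasure_density) measurable
  also have "\<dots> \<le> (\<integral>\<^sup>+\<omega>. ennreal (exp c) * indicator A \<omega> \<partial>sample n \<theta>')"
    by (intro nn_integral_mono) (auto simp: indicator_def le intro!: ennreal_leI)
  also have "\<dots> = ennreal (exp c) * emeasure (sample n \<theta>') A"
    by (intro nn_integral_cmult_indicator) measurable
  finally show ?thesis
    by (simp add: S.emeasure_eq_measure S'.emeasure_eq_measure ennreal_mult'[symmetric])
qed

text \<open>
  A law of large numbers for the log-likelihood ratio, by a Chernoff bound in the form of a change of
  measure. The deviation event says that the sample mean is displaced from its expectation in direction
  \<open>\<theta> - \<theta>'\<close>. Under the parameter \<open>\<theta> + t * (\<theta> - \<theta>')\<close>, shifted in the same direction, it is more likely: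
  its probability under \<open>\<theta>\<close> is at most \<open>exp (n * g t)\<close> times that under the shifted parameter. The
  function \<open>g\<close> vanishes at 0 and has derivative \<open>- \<epsilon>\<close> there, since \<open>bregman \<theta>\<close> is flat at \<open>\<theta>\<close>, so
  \<open>g t\<close> is negative for small \<open>t > 0\<close>.
\<close>
lemma llr_concentrates:
  assumes "\<theta> \<in> \<Theta>" "\<theta>' \<in> \<Theta>" "\<epsilon> > 0"
  shows "(\<lambda>n. measure (sample n \<theta>) {\<omega> \<in> space (\<Pi>\<^sub>M i\<in>{..<n}. borel).
      log_likelihood_ratio n \<theta> \<theta>' \<omega> > real n * (bregman \<theta> \<theta>' + \<epsilon>)}) \<longlonglongrightarrow> 0"
    (is "(\<lambda>n. measure _ (?B n)) \<longlonglongrightarrow> 0")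
proof -
  define u where "u = \<theta> - \<theta>'"
  define g where "g t = bregman \<theta> (\<theta> + t * u) - t * \<epsilon>" for t
  have "((\<lambda>t. b (\<theta> + t * u)) has_real_derivative deriv b \<theta> * u) (at 0)"
    by (rule DERIV_chain2[where f=b and g="\<lambda>t. \<theta> + t * u"])
      (use assms in \<open>auto intro!: derivative_eq_intros DERIV_b\<close>)
  then have "(g has_real_derivative - \<epsilon>) (at 0)"
    unfolding g_def bregman_def by (auto intro!: derivative_eq_intros)
  then obtain d where d: "d > 0" "\<And>h. 0 < h \<Longrightarrow> h < d \<Longrightarrow> g h < g 0"
    using DERIV_neg_dec_right[of g "- \<epsilon>" 0] assms(3) by auto
  have "((\<lambda>t. \<theta> + t * u) \<longlongrightarrow> \<theta> + 0 * u) (at_right 0)"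
    by (intro tendsto_intros)
  then have "eventually (\<lambda>t. \<theta> + t * u \<in> \<Theta>) (at_right 0)"
    using topological_tendstoD open_params assms(1) by fastforce
  moreover have "eventually (\<lambda>t. t \<in> {0<..<d}) (at_right 0)"
    using d(1) by (rule eventually_at_right_real)
  ultimately have "eventually (\<lambda>t. \<theta> + t * u \<in> \<Theta> \<and> t \<in> {0<..<d}) (at_right 0)"
    by (rule eventually_conj)
  then obtain t where t: "\<theta> + t * u \<in> \<Theta>" "0 < t" "t < d"
    using eventually_happens'[OF trivial_limit_at_right_real] by auto
  have neg: "g t < 0" using d(2)[OF t(2,3)] by (simp add: g_def bregman_def)
  have bound: "measure (sample n \<theta>) (?B n) \<le> exp (g t) ^ n" for n
  proof -
    interpret S': prob_space "sample n (\<theta> + t * u)" by (rule prob_space_sample[OF t(1)])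
    have "measure (sample n \<theta>) (?B n) \<le> exp (real n * g t) * measure (sample n (\<theta> + t * u)) (?B n)"
    proof (rule change_of_measure[OF assms(1) t(1)])
      fix \<omega> assume "\<omega> \<in> ?B n"
      then have "real n * (bregman \<theta> \<theta>' + \<epsilon>) < u * (\<Sum>i<n. \<omega> i) - real n * (b \<theta> - b \<theta>')"
        by (simp add: log_likelihood_ratio_def u_def)
      then have "t * (real n * (bregman \<theta> \<theta>' + \<epsilon>)) \<le>
          t * (u * (\<Sum>i<n. \<omega> i) - real n * (b \<theta> - b \<theta>'))"
        using t(2) by (intro mult_left_mono) auto
      then show "log_likelihood_ratio n \<theta> (\<theta> + t * u) \<omega> \<le> real n * g t"
        by (simp add: log_likelihood_ratio_def g_def bregman_def u_def algebra_simps)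
    qed measurable
    also have "\<dots> \<le> exp (real n * g t) * 1"
      by (intro mult_left_mono) auto
    finally show ?thesis by (simp add: exp_of_nat_mult)
  qed
  have decay: "(\<lambda>n. exp (g t) ^ n) \<longlonglongrightarrow> 0"
    using neg by (intro LIMSEQ_realpow_zero) auto
  show ?thesis
  proof (rule tendsto_sandwich[OF _ _ tendsto_const decay])
    show "\<forall>\<^sub>F n in sequentially. 0 \<le> measure (sample n \<theta>) (?B n)"
      by (intro always_eventually allI measure_nonneg)
    show "\<forall>\<^sub>F n in sequentially. measure (sample n \<theta>) (?B n) \<le> exp (g t) ^ n"
      by (intro always_eventually allI bound)
  qed
qed

text \<open>
  The information-theoretic core. Removing from \<open>E \<delta>\<close> the atypical samples, on which the log-likelihood
  ratio exceeds \<open>N \<delta> * (bregman \<theta> \<theta>' + \<epsilon>)\<close>, leaves an event of probability above \<open>1 / 2\<close>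
  under \<open>\<theta>\<close>. The change of measure bounds that probability by \<open>exp (N \<delta> * (bregman \<theta> \<theta>' + \<epsilon>)) * \<delta>\<close>. It remains to
  take logarithms, divide by \<open>ln (1 / \<delta>)\<close> and let first \<open>\<delta>\<close> and then \<open>\<epsilon>\<close> tend to 0.
\<close>
lemma sample_rate_lower_bound:
  assumes \<theta>: "\<theta> \<in> \<Theta>" and \<theta>': "\<theta>' \<in> \<Theta>"
    and N: "filterlim N at_top (at_right 0)" and rate: "sample_rate N (ereal k)"
    and E: "\<forall>\<^sub>F \<delta> in at_right 0. E \<delta> \<in> sets (\<Pi>\<^sub>M i\<in>{..<N \<delta>}. borel)"
    and rare: "\<forall>\<^sub>F \<delta> in at_right 0. measure (sample (N \<delta>) \<theta>') (E \<delta>) \<le> \<delta>"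
    and typical: "((\<lambda>\<delta>. measure (sample (N \<delta>) \<theta>) (E \<delta>)) \<longlongrightarrow> 1) (at_right 0)"
  shows "1 \<le> k * bregman \<theta> \<theta>'"
proof -
  have log_lim: "filterlim (\<lambda>\<delta>::real. ln (1 / \<delta>)) at_top (at_right 0)"
    by (intro filterlim_compose[OF ln_at_top])
      (use filterlim_inverse_at_top_right in \<open>simp add: inverse_eq_divide\<close>)
  have rate': "((\<lambda>\<delta>. real (N \<delta>) / ln (1 / \<delta>)) \<longlongrightarrow> k) (at_right 0)"
    using rate by (simp add: sample_rate_def)
  have eps: "1 \<le> k * (bregman \<theta> \<theta>' + \<epsilon>)" if "\<epsilon> > 0" for \<epsilon>
  proof -
    define D where "D = bregman \<theta> \<theta>' + \<epsilon>"
    define B where "B n = {\<omega> \<in> space (\<Pi>\<^sub>M i\<in>{..<n}. borel).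
        log_likelihood_ratio n \<theta> \<theta>' \<omega> > real n * D}" for n
    have [measurable]: "B n \<in> sets (\<Pi>\<^sub>M i\<in>{..<n}. borel)" for n
      unfolding B_def by measurable
    have "(\<lambda>n. measure (sample n \<theta>) (B n)) \<longlonglongrightarrow> 0"
      unfolding B_def D_def by (rule llr_concentrates[OF \<theta> \<theta>' that])
    then have "((\<lambda>\<delta>. measure (sample (N \<delta>) \<theta>) (B (N \<delta>))) \<longlongrightarrow> 0) (at_right 0)"
      using N by (rule filterlim_compose)
    from tendsto_diff[OF typical this]
    have "((\<lambda>\<delta>. measure (sample (N \<delta>) \<theta>) (E \<delta>) - measure (sample (N \<delta>) \<theta>) (B (N \<delta>))) \<longlongrightarrow> 1)
        (at_right 0)"
      by simp
    then have half: "\<forall>\<^sub>F \<delta> in at_right 0.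
        1/2 < measure (sample (N \<delta>) \<theta>) (E \<delta>) - measure (sample (N \<delta>) \<theta>) (B (N \<delta>))"
      by (rule order_tendstoD) simp
    have small: "\<forall>\<^sub>F \<delta>::real in at_right 0. \<delta> \<in> {0<..<1}"
      by (rule eventually_at_right_real) simp
    have ev: "\<forall>\<^sub>F \<delta> in at_right 0. 1 - ln 2 / ln (1 / \<delta>) \<le> real (N \<delta>) / ln (1 / \<delta>) * D"
      using half small E rare
    proof eventually_elim
      case (elim \<delta>)
      interpret S: prob_space "sample (N \<delta>) \<theta>" by (rule prob_space_sample[OF \<theta>])
      interpret S': prob_space "sample (N \<delta>) \<theta>'" by (rule prob_space_sample[OF \<theta>'])
      note [measurable] = elim(3)
      have "measure (sample (N \<delta>) \<theta>) (E \<delta>) - measure (sample (N \<delta>) \<theta>) (B (N \<delta>)) \<le>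
          measure (sample (N \<delta>) \<theta>) (E \<delta> - B (N \<delta>))"
        using S.finite_measure_Diff'[of "E \<delta>" "B (N \<delta>)"]
          S.finite_measure_mono[of "E \<delta> \<inter> B (N \<delta>)" "B (N \<delta>)"]
        by (auto simp: sets_sample)
      also have "\<dots> \<le> exp (real (N \<delta>) * D) * measure (sample (N \<delta>) \<theta>') (E \<delta> - B (N \<delta>))"
        using sets.sets_into_space[OF elim(3)]
        by (intro change_of_measure[OF \<theta> \<theta>']) (auto simp: B_def not_less)
      also have "\<dots> \<le> exp (real (N \<delta>) * D) * measure (sample (N \<delta>) \<theta>') (E \<delta>)"
        by (intro mult_left_mono S'.finite_measure_mono) (auto simp: sets_sample)
      also have "\<dots> \<le> exp (real (N \<delta>) * D) * \<delta>"
        using elim(4) by (intro mult_left_mono) auto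
      finally have "1/2 < exp (real (N \<delta>) * D) * \<delta>" using elim(1) by linarith
      then have "ln (1/2) < ln (exp (real (N \<delta>) * D) * \<delta>)"
        using elim(2) by (subst ln_less_cancel_iff) auto
      then have "ln (1 / \<delta>) - ln 2 \<le> real (N \<delta>) * D"
        using elim(2) by (simp add: ln_mult ln_div)
      moreover have pos: "ln (1 / \<delta>) > 0" using elim(2) by simp
      ultimately have "(ln (1 / \<delta>) - ln 2) / ln (1 / \<delta>) \<le> real (N \<delta>) * D / ln (1 / \<delta>)"
        by (intro divide_right_mono) auto
      with pos show ?case by (simp add: diff_divide_distrib)
    qed
    have "((\<lambda>\<delta>::real. ln 2 / ln (1 / \<delta>)) \<longlongrightarrow> 0) (at_right 0)"
      by (intro real_tendsto_divide_at_top[OF tendsto_const] log_lim)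
    from tendsto_diff[OF tendsto_const[of 1] this]
    have "((\<lambda>\<delta>::real. 1 - ln 2 / ln (1 / \<delta>)) \<longlongrightarrow> 1) (at_right 0)"
      by simp
    moreover have "((\<lambda>\<delta>. real (N \<delta>) / ln (1 / \<delta>) * D) \<longlongrightarrow> k * D) (at_right 0)"
      by (intro tendsto_mult rate' tendsto_const)
    ultimately show ?thesis
      using tendsto_le[OF trivial_limit_at_right_real _ _ ev] unfolding D_def by blast
  qed
  have "((\<lambda>\<epsilon>. k * (bregman \<theta> \<theta>' + \<epsilon>)) \<longlongrightarrow> k * (bregman \<theta> \<theta>' + 0)) (at_right 0)"
    by (intro tendsto_intros)
  then have "1 \<le> k * (bregman \<theta> \<theta>' + 0)"
    by (rule tendsto_lowerbound)
      (auto intro: eventually_mono[OF eventually_at_right_less eps])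
  then show ?thesis by simp
qed

section \<open>Limits of the endpoints of a stable policy\<close>

text \<open>
  The open set \<open>U\<close> isolates the behaviour of one endpoint: it contains the limit of that endpoint under
  \<open>\<theta>\<close>, and an endpoint in \<open>U\<close> means that the interval misses the mean of \<open>P \<theta>'\<close>. The first makes the event
  typical under \<open>\<theta>\<close>, the second makes it rare under \<open>\<theta>'\<close> by coverage. Both endpoints, and the
  case \<open>\<theta>' = \<theta>\<close>, are instances.
\<close>
lemma endpoint_limit_bound:
  assumes \<theta>: "\<theta> \<in> \<Theta>" and \<theta>': "\<theta>' \<in> \<Theta>" and \<pi>: "\<pi> \<in> ci_policies \<xi> b"
    and N: "filterlim N at_top (at_right 0)" and rate: "sample_rate N (ereal k)"
    and Z: "Z = fst \<pi> \<or> Z = snd \<pi>"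
    and lim: "conv_in_prob (iid (P \<theta>)) (\<lambda>\<delta> \<omega>. Z (N \<delta>) \<delta> (restrict \<omega> {..<N \<delta>})) c"
    and U: "open U" "c \<in> U"
    and miss: "\<And>n \<delta> \<omega>. n \<ge> 1 \<Longrightarrow> \<delta> \<in> {0<..<1} \<Longrightarrow> Z n \<delta> (restrict \<omega> {..<n}) \<in> U \<Longrightarrow>
      ereal (deriv b \<theta>') \<notin> {ci_lower \<pi> n \<delta> \<omega>..ci_upper \<pi> n \<delta> \<omega>}"
  shows "1 \<le> k * bregman \<theta> \<theta>'"
proof -
  define E where "E \<delta> = {x \<in> space (\<Pi>\<^sub>M i\<in>{..<N \<delta>}. borel). Z (N \<delta>) \<delta> x \<in> U}" for \<delta>
  have endpoints: "fst \<pi> n \<delta> \<in> borel_measurable (\<Pi>\<^sub>M i\<in>{..<n}. borel)"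
      "snd \<pi> n \<delta> \<in> borel_measurable (\<Pi>\<^sub>M i\<in>{..<n}. borel)"
    if "n \<ge> 1" "\<delta> \<in> {0<..<1}" for n \<delta>
    using \<pi> that by (auto simp: ci_policies_def policies_def)
  have good: "\<forall>\<^sub>F \<delta> in at_right 0. N \<delta> \<ge> 1 \<and> \<delta> \<in> {0<..<1}"
    using N eventually_at_right_real[of 0 1]
    by (auto simp: filterlim_at_top intro: eventually_conj)
  have E_sets: "E \<delta> \<in> sets (\<Pi>\<^sub>M i\<in>{..<N \<delta>}. borel)" if "N \<delta> \<ge> 1" "\<delta> \<in> {0<..<1}" for \<delta>
  proof -
    have [measurable]: "Z (N \<delta>) \<delta> \<in> borel_measurable (\<Pi>\<^sub>M i\<in>{..<N \<delta>}. borel)" "U \<in> sets borel"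
      using Z endpoints[OF that] U by auto
    show ?thesis unfolding E_def by measurable
  qed
  have E_iff: "{\<omega> \<in> space (iid (P t)). restrict \<omega> {..<N \<delta>} \<in> E \<delta>} =
      {\<omega> \<in> space (iid (P t)). Z (N \<delta>) \<delta> (restrict \<omega> {..<N \<delta>}) \<in> U}" for t \<delta>
    by (auto simp: E_def space_PiM)
  have E_measure: "measure (sample (N \<delta>) t) (E \<delta>) =
      measure (iid (P t)) {\<omega> \<in> space (iid (P t)). Z (N \<delta>) \<delta> (restrict \<omega> {..<N \<delta>}) \<in> U}"
    if "N \<delta> \<ge> 1" "\<delta> \<in> {0<..<1}" "t \<in> \<Theta>" for \<delta> t
    using measure_iid_restrict(2)[OF prob_space_P[OF that(3)] sets_P E_sets[OF that(1,2)]]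
    by (simp add: E_iff)
  have "measure (sample (N \<delta>) \<theta>') (E \<delta>) \<le> \<delta>" if *: "N \<delta> \<ge> 1" "\<delta> \<in> {0<..<1}" for \<delta>
  proof -
    interpret I: prob_space "iid (P \<theta>')"
      unfolding iid_def by (intro prob_space_PiM prob_space_P \<theta>')
    let ?C = "{\<omega> \<in> space (iid (P \<theta>')).
      ereal (deriv b \<theta>') \<in> {ci_lower \<pi> (N \<delta>) \<delta> \<omega>..ci_upper \<pi> (N \<delta>) \<delta> \<omega>}}"
    let ?C' = "{x \<in> space (\<Pi>\<^sub>M i\<in>{..<N \<delta>}. borel).
      fst \<pi> (N \<delta>) \<delta> x \<le> ereal (deriv b \<theta>') \<and> ereal (deriv b \<theta>') \<le> snd \<pi> (N \<delta>) \<delta> x}"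
    note [measurable] = endpoints[OF *]
    have "?C' \<in> sets (\<Pi>\<^sub>M i\<in>{..<N \<delta>}. borel)" by measurable
    from measure_iid_restrict(1)[OF prob_space_P[OF \<theta>'] sets_P this]
    have "{\<omega> \<in> space (iid (P \<theta>')). restrict \<omega> {..<N \<delta>} \<in> ?C'} \<in> sets (iid (P \<theta>'))" .
    also have "{\<omega> \<in> space (iid (P \<theta>')). restrict \<omega> {..<N \<delta>} \<in> ?C'} = ?C"
      by (auto simp: ci_lower_def ci_upper_def space_PiM)
    finally have C: "?C \<in> sets (iid (P \<theta>'))" .
    have "P \<theta>' \<in> expfam \<xi> b" using \<theta>' by (simp add: expfam_def)
    then have "1 - \<delta> \<le> measure (iid (P \<theta>')) ?C"
      using \<pi> * mean_P[OF \<theta>'] unfolding ci_policies_def by fastforce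
    moreover have "measure (iid (P \<theta>'))
        {\<omega> \<in> space (iid (P \<theta>')). Z (N \<delta>) \<delta> (restrict \<omega> {..<N \<delta>}) \<in> U} \<le>
        measure (iid (P \<theta>')) (space (iid (P \<theta>')) - ?C)"
      using C miss[OF *] by (intro I.finite_measure_mono) auto
    ultimately show ?thesis
      using E_measure[OF * \<theta>'] I.prob_compl[OF C] by simp
  qed
  then have rare: "\<forall>\<^sub>F \<delta> in at_right 0. measure (sample (N \<delta>) \<theta>') (E \<delta>) \<le> \<delta>"
    using good by (auto elim: eventually_mono)
  have "\<forall>\<^sub>F \<delta> in at_right 0. measure (iid (P \<theta>))
      {\<omega> \<in> space (iid (P \<theta>)). Z (N \<delta>) \<delta> (restrict \<omega> {..<N \<delta>}) \<in> U} =
      measure (sample (N \<delta>) \<theta>) (E \<delta>)"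
    using good E_measure[OF _ _ \<theta>] by (auto elim!: eventually_mono)
  moreover have "((\<lambda>\<delta>. measure (iid (P \<theta>))
      {\<omega> \<in> space (iid (P \<theta>)). Z (N \<delta>) \<delta> (restrict \<omega> {..<N \<delta>}) \<in> U}) \<longlongrightarrow> 1) (at_right 0)"
    using lim U by (simp add: conv_in_prob_def)
  ultimately have typical: "((\<lambda>\<delta>. measure (sample (N \<delta>) \<theta>) (E \<delta>)) \<longlongrightarrow> 1) (at_right 0)"
    by (rule Lim_transform_eventually[rotated])
  show ?thesis
    by (rule sample_rate_lower_bound[OF \<theta> \<theta>' N rate _ rare typical])
      (use good E_sets in \<open>auto elim: eventually_mono\<close>)
qed

end

text \<open>
  The limits belong to one member \<open>P \<theta>\<close> and one choice \<open>N\<close> of sample sizes, while coverage is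
  demanded at every member of the family: the argument plays the two off against each other.
\<close>
locale stable_policy = canonical_family +
  fixes \<theta> :: real and N :: "real \<Rightarrow> nat" and \<pi> :: policy and \<mu>L \<mu>R :: ereal
  assumes param: "\<theta> \<in> \<Theta>" and policy: "\<pi> \<in> ci_policies \<xi> b"
    and N: "filterlim N at_top (at_right 0)"
    and endpoints: "limiting_endpoints (P \<theta>) N \<pi> \<mu>L \<mu>R"
begin

lemma mean_between: "\<mu>L \<le> ereal (deriv b \<theta>)" "ereal (deriv b \<theta>) \<le> \<mu>R"
  using endpoints mean_P[OF param] by (auto simp: limiting_endpoints_def)

lemma
  shows lim_lower: "conv_in_prob (iid (P \<theta>)) (\<lambda>\<delta> \<omega>. fst \<pi> (N \<delta>) \<delta> (restrict \<omega> {..<N \<delta>})) \<mu>L"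
    and lim_upper: "conv_in_prob (iid (P \<theta>)) (\<lambda>\<delta> \<omega>. snd \<pi> (N \<delta>) \<delta> (restrict \<omega> {..<N \<delta>})) \<mu>R"
  using endpoints by (simp_all add: limiting_endpoints_def ci_lower_def[abs_def] ci_upper_def[abs_def])

text \<open>
  Otherwise the upper endpoint would typically fall below \<open>deriv b \<theta>'\<close>, so that the interval misses that
  mean, although \<open>\<theta>'\<close> is too close to \<open>\<theta>\<close> to be told apart with so few observations.
\<close>
lemma upper_limit_ge:
  assumes rate: "sample_rate N (ereal k)" and \<theta>': "\<theta>' \<in> \<Theta>" "k * bregman \<theta> \<theta>' < 1"
  shows "ereal (deriv b \<theta>') \<le> \<mu>R"
proof (rule ccontr)
  assume "\<not> ereal (deriv b \<theta>') \<le> \<mu>R"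
  then have "1 \<le> k * bregman \<theta> \<theta>'"
    by (intro endpoint_limit_bound[where Z="snd \<pi>" and U="{..<ereal (deriv b \<theta>')}",
          OF param \<theta>'(1) policy N rate _ lim_upper])
      (auto simp: ci_upper_def)
  with \<theta>' show False by simp
qed

lemma lower_limit_le:
  assumes rate: "sample_rate N (ereal k)" and \<theta>': "\<theta>' \<in> \<Theta>" "k * bregman \<theta> \<theta>' < 1"
  shows "\<mu>L \<le> ereal (deriv b \<theta>')"
proof (rule ccontr)
  assume "\<not> \<mu>L \<le> ereal (deriv b \<theta>')"
  then have "1 \<le> k * bregman \<theta> \<theta>'"
    by (intro endpoint_limit_bound[where Z="fst \<pi>" and U="{ereal (deriv b \<theta>')<..}",
          OF param \<theta>'(1) policy N rate _ lim_lower])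
      (auto simp: ci_lower_def)
  with \<theta>' show False by simp
qed

lemma interval_in_hull:
  assumes "n \<ge> 1" "\<delta> \<in> {0<..<1}" "x \<in> {ci_lower \<pi> n \<delta> \<omega>..ci_upper \<pi> n \<delta> \<omega>}"
  shows "mean_lower \<xi> b \<le> ci_lower \<pi> n \<delta> \<omega>" "ci_upper \<pi> n \<delta> \<omega> \<le> mean_upper \<xi> b"
proof -
  have "{ci_lower \<pi> n \<delta> \<omega>..ci_upper \<pi> n \<delta> \<omega>} \<subseteq> {mean_lower \<xi> b..mean_upper \<xi> b}"
    using policy assms(1,2) unfolding ci_policies_def policies_def by blast
  then show "mean_lower \<xi> b \<le> ci_lower \<pi> n \<delta> \<omega>" "ci_upper \<pi> n \<delta> \<omega> \<le> mean_upper \<xi> b"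
    using order_trans[of "ci_lower \<pi> n \<delta> \<omega>" x "ci_upper \<pi> n \<delta> \<omega>"] assms(3) by simp_all
qed

text \<open>
  An upper endpoint beyond the hull of the means belongs to an empty interval. Such intervals miss the
  true mean, so \<open>endpoint_limit_bound\<close> applies with \<open>\<theta>' = \<theta>\<close> and gives \<open>1 \<le> k * 0\<close>.
\<close>
lemma upper_limit_le_mean_upper:
  assumes "sample_rate N (ereal k)"
  shows "\<mu>R \<le> mean_upper \<xi> b"
proof (rule ccontr)
  assume "\<not> \<mu>R \<le> mean_upper \<xi> b"
  then have "1 \<le> k * bregman \<theta> \<theta>"
  proof (intro endpoint_limit_bound[where Z="snd \<pi>" and U="{mean_upper \<xi> b<..}",
          OF param param policy N assms _ lim_upper])
    fix n \<delta> \<omega>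
    assume *: "n \<ge> (1::nat)" "\<delta> \<in> {0<..<(1::real)}"
      and "snd \<pi> n \<delta> (restrict \<omega> {..<n}) \<in> {mean_upper \<xi> b<..}"
    then have "\<not> ci_upper \<pi> n \<delta> \<omega> \<le> mean_upper \<xi> b"
      by (simp add: ci_upper_def)
    then show "ereal (deriv b \<theta>) \<notin> {ci_lower \<pi> n \<delta> \<omega>..ci_upper \<pi> n \<delta> \<omega>}"
      using interval_in_hull(2)[OF *] by blast
  qed auto
  then show False by (simp add: bregman_def)
qed

lemma mean_lower_le_lower_limit:
  assumes "sample_rate N (ereal k)"
  shows "mean_lower \<xi> b \<le> \<mu>L"
proof (rule ccontr)
  assume "\<not> mean_lower \<xi> b \<le> \<mu>L"
  then have "1 \<le> k * bregman \<theta> \<theta>"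
  proof (intro endpoint_limit_bound[where Z="fst \<pi>" and U="{..<mean_lower \<xi> b}",
          OF param param policy N assms _ lim_lower])
    fix n \<delta> \<omega>
    assume *: "n \<ge> (1::nat)" "\<delta> \<in> {0<..<(1::real)}"
      and "fst \<pi> n \<delta> (restrict \<omega> {..<n}) \<in> {..<mean_lower \<xi> b}"
    then have "\<not> mean_lower \<xi> b \<le> ci_lower \<pi> n \<delta> \<omega>"
      by (simp add: ci_lower_def)
    then show "ereal (deriv b \<theta>) \<notin> {ci_lower \<pi> n \<delta> \<omega>..ci_upper \<pi> n \<delta> \<omega>}"
      using interval_in_hull(1)[OF *] by blast
  qed auto
  then show False by (simp add: bregman_def)
qed

lemma no_learning:
  assumes rate: "sample_rate N 0"
  shows "\<mu>L = mean_lower \<xi> b" "\<mu>R = mean_upper \<xi> b"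
proof -
  have rate0: "sample_rate N (ereal 0)" using rate by (simp add: zero_ereal_def)
  have "\<mu>L \<le> mean_lower \<xi> b"
    unfolding mean_lower_def mean_range_eq
    using lower_limit_le[OF rate0] by (auto intro!: INF_greatest)
  then show "\<mu>L = mean_lower \<xi> b"
    using mean_lower_le_lower_limit[OF rate0] by simp
  have "mean_upper \<xi> b \<le> \<mu>R"
    unfolding mean_upper_def mean_range_eq
    using upper_limit_ge[OF rate0] by (auto intro!: SUP_least)
  then show "\<mu>R = mean_upper \<xi> b"
    using upper_limit_le_mean_upper[OF rate0] by simp
qed

text \<open>
  The limit dominates every mean strictly between \<open>deriv b \<theta>\<close> and the solution, since these are at
  divergence less than \<open>1 / k\<close>; it therefore dominates their supremum. Without a solution this
  holds for all means above \<open>deriv b \<theta>\<close>.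
\<close>
lemma mu_R_star_le:
  assumes "k > 0" and rate: "sample_rate N (ereal k)"
  shows "mu_R_star \<xi> b (deriv b \<theta>) k \<le> \<mu>R"
proof (cases "\<exists>m. upper_solution \<xi> b (deriv b \<theta>) k m")
  case True
  then obtain m where m: "upper_solution \<xi> b (deriv b \<theta>) k m" by blast
  then have "\<exists>!m. upper_solution \<xi> b (deriv b \<theta>) k m"
    using upper_solution_alternative[OF param \<open>k > 0\<close>] by (auto simp: upper_solution_def)
  with m have star: "mu_R_star \<xi> b (deriv b \<theta>) k = ereal m"
    by (auto simp: mu_R_star_def the1_equality)
  obtain s where s: "s \<in> \<Theta>" "m = deriv b s" "deriv b \<theta> < m" "bregman \<theta> s = 1 / k"
    using m param by (auto simp: upper_solution_def mean_range_eq kl_mean_eq)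
  have "ereal m \<le> \<mu>R"
  proof (rule dense_le_bounded)
    show "ereal (deriv b \<theta>) < ereal m" using s by simp
  next
    fix w assume w: "ereal (deriv b \<theta>) < w" "w < ereal m"
    then obtain y where y: "w = ereal y" by (cases w) auto
    obtain t where t: "t \<in> \<Theta>" "\<theta> < t" "t < s" "deriv b t = y"
      using deriv_b_between[OF param s(1), of y] w s(2) y by auto
    then have "bregman \<theta> t < 1 / k"
      using bregman_strict_mono[of \<theta> t s] param s by simp
    then have "k * bregman \<theta> t < 1" using \<open>k > 0\<close> by (simp add: field_simps)
    then show "w \<le> \<mu>R" using upper_limit_ge[OF rate t(1)] t y by simp
  qed
  then show ?thesis by (simp add: star)
next
  case False
  then have close: "\<And>t. t \<in> \<Theta> \<Longrightarrow> deriv b \<theta> < deriv b t \<Longrightarrow> bregman \<theta> t < 1 / k"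
    using upper_solution_alternative[OF param \<open>k > 0\<close>] param
    by (auto simp: mean_range_eq kl_mean_eq)
  have "mean_upper \<xi> b \<le> \<mu>R"
    unfolding mean_upper_def mean_range_eq
  proof (rule SUP_least, clarify)
    fix t assume t: "t \<in> \<Theta>"
    show "ereal (deriv b t) \<le> \<mu>R"
    proof (cases "deriv b \<theta> < deriv b t")
      case True
      then have "k * bregman \<theta> t < 1" using close[OF t] \<open>k > 0\<close> by (simp add: field_simps)
      then show ?thesis by (rule upper_limit_ge[OF rate t])
    next
      case False
      then have "ereal (deriv b t) \<le> ereal (deriv b \<theta>)" by simp
      then show ?thesis using mean_between(2) by (rule order_trans)
    qed
  qed
  with False show ?thesis by (simp add: mu_R_star_def)
qed

lemma mu_L_star_ge:
  assumes "k > 0" and rate: "sample_rate N (ereal k)"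
  shows "\<mu>L \<le> mu_L_star \<xi> b (deriv b \<theta>) k"
proof (cases "\<exists>m. lower_solution \<xi> b (deriv b \<theta>) k m")
  case True
  then obtain m where m: "lower_solution \<xi> b (deriv b \<theta>) k m" by blast
  then have "\<exists>!m. lower_solution \<xi> b (deriv b \<theta>) k m"
    using lower_solution_alternative[OF param \<open>k > 0\<close>] by (auto simp: lower_solution_def)
  with m have star: "mu_L_star \<xi> b (deriv b \<theta>) k = ereal m"
    by (auto simp: mu_L_star_def the1_equality)
  obtain s where s: "s \<in> \<Theta>" "m = deriv b s" "m < deriv b \<theta>" "bregman \<theta> s = 1 / k"
    using m param by (auto simp: lower_solution_def mean_range_eq kl_mean_eq)
  have "\<mu>L \<le> ereal m"
  proof (rule dense_ge_bounded)
    show "ereal m < ereal (deriv b \<theta>)" using s by simp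
  next
    fix w assume w: "ereal m < w" "w < ereal (deriv b \<theta>)"
    then obtain y where y: "w = ereal y" by (cases w) auto
    obtain t where t: "t \<in> \<Theta>" "s < t" "t < \<theta>" "deriv b t = y"
      using deriv_b_between[OF s(1) param, of y] w s(2) y by auto
    then have "bregman \<theta> t < 1 / k"
      using bregman_strict_mono[of \<theta> t s] param s by simp
    then have "k * bregman \<theta> t < 1" using \<open>k > 0\<close> by (simp add: field_simps)
    then show "\<mu>L \<le> w" using lower_limit_le[OF rate t(1)] t y by simp
  qed
  then show ?thesis by (simp add: star)
next
  case False
  then have close: "\<And>t. t \<in> \<Theta> \<Longrightarrow> deriv b t < deriv b \<theta> \<Longrightarrow> bregman \<theta> t < 1 / k"
    using lower_solution_alternative[OF param \<open>k > 0\<close>] param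
    by (auto simp: mean_range_eq kl_mean_eq)
  have "\<mu>L \<le> mean_lower \<xi> b"
    unfolding mean_lower_def mean_range_eq
  proof (rule INF_greatest, clarify)
    fix t assume t: "t \<in> \<Theta>"
    show "\<mu>L \<le> ereal (deriv b t)"
    proof (cases "deriv b t < deriv b \<theta>")
      case True
      then have "k * bregman \<theta> t < 1" using close[OF t] \<open>k > 0\<close> by (simp add: field_simps)
      then show ?thesis by (rule lower_limit_le[OF rate t])
    next
      case False
      then have "ereal (deriv b \<theta>) \<le> ereal (deriv b t)" by simp
      with mean_between(1) show ?thesis by (rule order_trans)
    qed
  qed
  with False show ?thesis by (simp add: mu_L_star_def)
qed

end

theorem theorem1:
  fixes \<xi> \<nu> :: "real measure" and b :: "real \<Rightarrow> real" and \<mu> :: real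
    and N :: "real \<Rightarrow> nat" and \<pi> :: policy and \<mu>L \<mu>R :: ereal
  assumes "exponential_family \<xi> b"
    and "\<nu> \<in> expfam \<xi> b" and "\<mu> = mean \<nu>"
    and "filterlim N at_top (at_right 0)"
    and "\<pi> \<in> stable_ci_policies \<xi> b \<nu> N"
    and "limiting_endpoints \<nu> N \<pi> \<mu>L \<mu>R"
  shows "(sample_rate N 0 \<longrightarrow>
           \<mu>R - \<mu>L = mean_upper \<xi> b - mean_lower \<xi> b \<and>
           conv_in_prob (iid \<nu>) (\<lambda>\<delta>. ci_lower \<pi> (N \<delta>) \<delta>) (mean_lower \<xi> b) \<and>
           conv_in_prob (iid \<nu>) (\<lambda>\<delta>. ci_upper \<pi> (N \<delta>) \<delta>) (mean_upper \<xi> b)) \<and>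
         (\<forall>k::real. k > 0 \<and> sample_rate N (ereal k) \<longrightarrow>
           ((\<exists>!m. upper_solution \<xi> b \<mu> k m) \<or>
             (\<forall>m\<in>mean_range \<xi> b. m > \<mu> \<longrightarrow> kl_mean \<xi> b \<mu> m < 1 / k)) \<and>
           ((\<exists>!m. lower_solution \<xi> b \<mu> k m) \<or>
             (\<forall>m\<in>mean_range \<xi> b. m < \<mu> \<longrightarrow> kl_mean \<xi> b \<mu> m < 1 / k)) \<and>
           \<mu>R - \<mu>L \<ge> mu_R_star \<xi> b \<mu> k - mu_L_star \<xi> b \<mu> k)"
proof -
  interpret canonical_family \<xi> b by unfold_locales fact
  obtain \<theta> where \<theta>: "\<theta> \<in> nat_params \<xi>" "\<nu> = expfam_dist \<xi> b \<theta>"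
    using assms(2) by (auto simp: expfam_def)
  interpret stable_policy \<xi> b \<theta> N \<pi> \<mu>L \<mu>R
    using assms(4-6) \<theta> by unfold_locales (simp_all add: stable_ci_policies_def)
  have \<mu>: "\<mu> = deriv b \<theta>"
    using assms(3) \<theta> mean_P by simp
  show ?thesis
  proof (intro conjI allI impI; (elim conjE)?)
    assume "sample_rate N 0"
    note lims = no_learning[OF this]
    show "\<mu>R - \<mu>L = mean_upper \<xi> b - mean_lower \<xi> b"
      by (simp add: lims)
    show "conv_in_prob (iid \<nu>) (\<lambda>\<delta>. ci_lower \<pi> (N \<delta>) \<delta>) (mean_lower \<xi> b)"
      "conv_in_prob (iid \<nu>) (\<lambda>\<delta>. ci_upper \<pi> (N \<delta>) \<delta>) (mean_upper \<xi> b)"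
      using assms(6) by (simp_all add: limiting_endpoints_def lims)
  next
    fix k :: real assume k: "k > 0" and rate: "sample_rate N (ereal k)"
    show "(\<exists>!m. upper_solution \<xi> b \<mu> k m) \<or>
        (\<forall>m\<in>mean_range \<xi> b. m > \<mu> \<longrightarrow> kl_mean \<xi> b \<mu> m < 1 / k)"
      unfolding \<mu> by (rule upper_solution_alternative[OF \<theta>(1) k])
    show "(\<exists>!m. lower_solution \<xi> b \<mu> k m) \<or>
        (\<forall>m\<in>mean_range \<xi> b. m < \<mu> \<longrightarrow> kl_mean \<xi> b \<mu> m < 1 / k)"
      unfolding \<mu> by (rule lower_solution_alternative[OF \<theta>(1) k])
    show "mu_R_star \<xi> b \<mu> k - mu_L_star \<xi> b \<mu> k \<le> \<mu>R - \<mu>L"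
      unfolding \<mu> by (intro ereal_minus_mono mu_R_star_le[OF k rate] mu_L_star_ge[OF k rate])
  qed
qed

end
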